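(* Let $\mathbb{F}$ be a field of characteristic not equal to $2$ with $|\mathbb{F}|\ge 4$, let $\mathcal{A}$ be a unital algebra over $\mathbb{F}$, and let $\mathcal{M}$ be a unital $\mathcal{A}$-bimodule. Let $P\in\mathcal{A}$ be a non-trivial idempotent, $Q=I-P$, and use the Peirce notation $E_1=P$, $E_2=Q$, $\mathcal{A}_{ij}=E_i\mathcal{A}E_j$, $\mathcal{M}_{ij}=E_i\mathcal{M}E_j$, $A_{ij}=E_iAE_j$. Assume that every element of $\mathcal{A}_{11}$ is a linear combination of invertible elements of $\mathcal{A}_{11}$ and every element of $\mathcal{A}_{22}$ is a linear combination of invertible elements of $\mathcal{A}_{22}$. Let $C\in\mathcal{A}$ satisfy $C_{21}=0$. If $\Delta\in L(\mathcal{A},\mathcal{M})$ is Jordan derivable at $C$, then there exists $\delta\in L(\mathcal{A},\mathcal{M})$ such that $\Delta-\delta$ is an inner derivation and the following hold: (a) $\delta(P)A_{12}=A_{12}\delta(Q)$ for any $A_{12}\in\mathcal{A}_{12}$. (b) $A_{12}\delta(A_{12})=\delta(A_{12})A_{12}=0$ for any $A_{12}\in\mathcal{A}_{12}$. (c) $\delta(\mathcal{A}_{11})\subset\mathcal{M}_{11}$ and $\delta(\mathcal{A}_{22})\subset\mathcal{M}_{22}$. If $\mathcal{A}_{12}$ is left faithful with respect to $\mathcal{M}$, then (d) $\delta(P)\in C(\mathcal{A}_{11},\mathcal{M})$. (e) $\delta|_{\mathcal{A}_{11}}$ is a generalized derivation from $\mathcal{A}_{11}$ to $\mathcal{M}_{11}$.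 If $\mathcal{A}_{12}$ is right faithful with respect to $\mathcal{M}$, then (f) $\delta(Q)\in C(\mathcal{A}_{22},\mathcal{M})$. (g) $\delta|_{\mathcal{A}_{22}}$ is a generalized derivation from $\mathcal{A}_{22}$ to $\mathcal{M}_{22}$.
   Context: $L(\mathcal{A},\mathcal{M})$ is the set of all linear mappings from $\mathcal{A}$ to $\mathcal{M}$. For a subalgebra $\mathcal{S}\subseteq\mathcal{A}$ and an $\mathcal{S}$-bimodule $\mathcal{M}$, $C(\mathcal{S},\mathcal{M})=\{M\in\mathcal{M}: AM=MA \text{ for every } A\in\mathcal{S}\}$. A mapping $\delta\in L(\mathcal{A},\mathcal{M})$ is Jordan derivable at $C\in\mathcal{A}$ if $\delta(AB+BA)=\delta(A)B+A\delta(B)+\delta(B)A+B\delta(A)$ for all $A,B\in\mathcal{A}$ with $AB=C$. An inner derivation is a mapping of the form $A\mapsto MA-AM$ for some fixed $M\in\mathcal{M}$. A mapping $\delta\in L(\mathcal{A},\mathcal{M})$ is a generalized derivation if there exists $M_\delta\in C(\mathcal{A},\mathcal{M})$ such that $\delta(AB)=\delta(A)B+A\delta(B)-M_\delta AB$ for all $A,B\in\mathcal{A}$; the same definition is used with $\mathcal{A}_{ii}$, $\mathcal{M}_{ii}$ in place of $\mathcal{A}$, $\mathcal{M}$ (here $\mathcal{A}_{ii}$ is an algebra with unit $E_i$ and $\mathcal{M}_{ii}$ is a unital $\mathcal{A}_{ii}$-bimodule). Non-trivial idempotent means an idempotent different from $0$ and $I$. Invertible in $\mathcal{A}_{ii}$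 means invertible with respect to the unit $E_i$, with inverse in $\mathcal{A}_{ii}$. $\mathcal{A}_{ij}$ is left faithful with respect to $\mathcal{M}$ if for any $M\in\mathcal{M}$, $M\mathcal{A}_{ij}=\{0\}$ implies $ME_i=0$; it is right faithful with respect to $\mathcal{M}$ if for any $M\in\mathcal{M}$, $\mathcal{A}_{ij}M=\{0\}$ implies $E_jM=0$. *)

theory Defs
  imports "HOL-Computational_Algebra.Computational_Algebra"
begin

locale unital_algebra = vector_space scale
  for scale :: "'f::field \<Rightarrow> 'a::ring_1 \<Rightarrow> 'a" +
  assumes scale_mult_left: "scale c a * b = scale c (a * b)"
    and scale_mult_right: "a * scale c b = scale c (a * b)"

text \<open>Bimodules over an algebra are modules over the ground field as well, and both actions
  are bilinear over it.  The argument order of the two actions is that of the written products: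
  \<open>lact a m\<close> is \<open>a m\<close> and \<open>ract m a\<close> is \<open>m a\<close>.\<close>

locale unital_bimodule =
  unital_algebra scaleA + M: vector_space scaleM
  for scaleA :: "'f::field \<Rightarrow> 'a::ring_1 \<Rightarrow> 'a"
    and scaleM :: "'f \<Rightarrow> 'm::ab_group_add \<Rightarrow> 'm" +
  fixes lact :: "'a \<Rightarrow> 'm \<Rightarrow> 'm"
    and ract :: "'m \<Rightarrow> 'a \<Rightarrow> 'm"
  assumes lact_add_left: "lact (a + b) m = lact a m + lact b m"
    and lact_add_right: "lact a (m + n) = lact a m + lact a n"
    and lact_scale_left: "lact (scaleA c a) m = scaleM c (lact a m)"
    and lact_scale_right: "lact a (scaleM c m) = scaleM c (lact a m)"
    and ract_add_left: "ract (m + n) a = ract m a + ract n a"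
    and ract_add_right: "ract m (a + b) = ract m a + ract m b"
    and ract_scale_left: "ract (scaleM c m) a = scaleM c (ract m a)"
    and ract_scale_right: "ract m (scaleA c a) = scaleM c (ract m a)"
    and lact_assoc: "lact (a * b) m = lact a (lact b m)"
    and ract_assoc: "ract m (a * b) = ract (ract m a) b"
    and lact_ract_assoc: "ract (lact a m) b = lact a (ract m b)"
    and lact_one: "lact 1 m = m"
    and ract_one: "ract m 1 = m"

definition peirce :: "'a::ring_1 \<Rightarrow> 'a \<Rightarrow> 'a set" where
  "peirce E F = {E * A * F | A. True}"

definition peirce_bimod ::
  "('a::ring_1 \<Rightarrow> 'm \<Rightarrow> 'm) \<Rightarrow> ('m \<Rightarrow> 'a \<Rightarrow> 'm) \<Rightarrow> 'a \<Rightarrow> 'a \<Rightarrow> 'm set" where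
  "peirce_bimod lact ract E F = {ract (lact E M) F | M. True}"

text \<open>Invertible elements of the corner algebra with unit \<open>E\<close>.\<close>

definition corner_units :: "'a::ring_1 \<Rightarrow> 'a set" where
  "corner_units E = {A \<in> peirce E E. \<exists>B \<in> peirce E E. A * B = E \<and> B * A = E}"

definition left_faithful ::
  "('m::ab_group_add \<Rightarrow> 'a::ring_1 \<Rightarrow> 'm) \<Rightarrow> 'a \<Rightarrow> 'a \<Rightarrow> bool" where
  "left_faithful ract E F \<longleftrightarrow>
     (\<forall>M. {ract M A | A. A \<in> peirce E F} = {0} \<longrightarrow> ract M E = 0)"

definition right_faithful ::
  "('a::ring_1 \<Rightarrow> 'm::ab_group_add \<Rightarrow> 'm) \<Rightarrow> 'a \<Rightarrow> 'a \<Rightarrow> bool" where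
  "right_faithful lact E F \<longleftrightarrow>
     (\<forall>M. {lact A M | A. A \<in> peirce E F} = {0} \<longrightarrow> lact F M = 0)"

definition bimod_center ::
  "('a \<Rightarrow> 'm \<Rightarrow> 'm) \<Rightarrow> ('m \<Rightarrow> 'a \<Rightarrow> 'm) \<Rightarrow> 'a set \<Rightarrow> 'm set \<Rightarrow> 'm set" where
  "bimod_center lact ract S N = {M \<in> N. \<forall>A \<in> S. lact A M = ract M A}"

definition jordan_derivable_at ::
  "('a::ring_1 \<Rightarrow> 'm::ab_group_add \<Rightarrow> 'm) \<Rightarrow> ('m \<Rightarrow> 'a \<Rightarrow> 'm) \<Rightarrow> ('a \<Rightarrow> 'm) \<Rightarrow> 'a \<Rightarrow> bool"
  where
  "jordan_derivable_at lact ract D C \<longleftrightarrow>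
     (\<forall>A B. A * B = C \<longrightarrow>
        D (A * B + B * A) = ract (D A) B + lact A (D B) + ract (D B) A + lact B (D A))"

definition inner_derivation ::
  "('a \<Rightarrow> 'm::ab_group_add \<Rightarrow> 'm) \<Rightarrow> ('m \<Rightarrow> 'a \<Rightarrow> 'm) \<Rightarrow> ('a \<Rightarrow> 'm) \<Rightarrow> bool" where
  "inner_derivation lact ract D \<longleftrightarrow> (\<exists>M. \<forall>A. D A = ract M A - lact A M)"

text \<open>Generalized derivations from a subalgebra \<open>S\<close> (possibly with its own unit) to an
  \<open>S\<close>-bimodule \<open>N\<close> inside the ambient bimodule.  Only the values of \<open>D\<close> on \<open>S\<close> matter, so
  this speaks about the restriction of \<open>D\<close> to \<open>S\<close>.\<close>

definition generalized_derivation_on ::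
  "('f \<Rightarrow> 'a::ring_1 \<Rightarrow> 'a) \<Rightarrow> ('f \<Rightarrow> 'm::ab_group_add \<Rightarrow> 'm) \<Rightarrow>
   ('a \<Rightarrow> 'm \<Rightarrow> 'm) \<Rightarrow> ('m \<Rightarrow> 'a \<Rightarrow> 'm) \<Rightarrow> 'a set \<Rightarrow> 'm set \<Rightarrow> ('a \<Rightarrow> 'm) \<Rightarrow> bool" where
  "generalized_derivation_on scaleA scaleM lact ract S N D \<longleftrightarrow>
     (\<forall>A \<in> S. D A \<in> N) \<and>
     (\<forall>A \<in> S. \<forall>B \<in> S. D (A + B) = D A + D B) \<and>
     (\<forall>c. \<forall>A \<in> S. D (scaleA c A) = scaleM c (D A)) \<and>
     (\<exists>M \<in> bimod_center lact ract S N. \<forall>A \<in> S. \<forall>B \<in> S.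
        D (A * B) = ract (D A) B + lact A (D B) - ract (ract M A) B)"

end

theory Submission
  imports Defs
begin

text \<open>The Jordan defect \<open>J(A, B) = \<Delta>(AB + BA) - \<Delta>(A)B - A\<Delta>(B) - \<Delta>(B)A - B\<Delta>(A)\<close> is bilinear, is unchanged
  when an inner derivation is subtracted from \<open>\<Delta>\<close>, and vanishes at all factorizations \<open>AB = C\<close>.
  Since \<open>QCP = 0\<close>, invertible \<open>X\<close> and \<open>Y\<close> in the two corners and \<open>W\<close> in the off-diagonal corner
  give the factorization
  \<open>C = (tX + W + QCY\<inverse>) (t\<inverse>X\<inverse>(C - WY) + Y)\<close>.
  Comparing powers of \<open>t\<close>, and then the dependence on \<open>W\<close>, yields \<open>J(X, Y) = 0\<close>,
  \<open>J(XW, Y) = J(X, WY)\<close> and \<open>J(W, W) = 0\<close>, identities in which \<open>C\<close> no longer occurs and which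
  extend linearly to all of both corners.  All conclusions are Peirce components of these
  identities.\<close>

section \<open>Scalars, and quadratic polynomials with vector coefficients\<close>

text \<open>Interpolating a quadratic takes three points, and the parameter \<open>t\<close> must be
  invertible; this is where the size of the field enters. The infinite case is listed separately
  because \<open>card\<close> is 0 on infinite sets.\<close>

lemma ex_three_distinct_nonzero:
  assumes "infinite (UNIV :: 'f::field set) \<or> card (UNIV :: 'f::field set) \<ge> 4"
  obtains r s t :: "'f::field" where "r \<noteq> 0" "s \<noteq> 0" "t \<noteq> 0" "r \<noteq> s" "r \<noteq> t" "s \<noteq> t"
proof -
  have "infinite (UNIV - {0::'f}) \<or> card (UNIV - {0::'f}) \<ge> 3"
    using assms by (auto simp: card_Diff_singleton)
  then obtain T where "T \<subseteq> UNIV - {0::'f}" "card T = 3"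
    by (meson infinite_arbitrarily_large obtain_subset_with_card_n)
  then show thesis
    using that by (auto simp: card_3_iff)
qed

lemma two_neq_zero_of_CHAR:
  assumes "CHAR('f::field) \<noteq> 2"
  shows "(2::'f::field) \<noteq> 0"
proof
  assume "(2::'f) = 0"
  then have "CHAR('f) dvd 2"
    using of_nat_eq_0_iff_char_dvd[where 'a='f, of 2] by simp
  then have "CHAR('f) = 1 \<or> CHAR('f) = 2"
    using two_is_prime_nat by (auto simp: prime_nat_iff)
  then show False
    using assms CHAR_not_1[where 'a='f] by auto
qed

context vector_space
begin

text \<open>Newton's divided differences: differencing two values removes \<open>a\<close> and
  leaves a multiple of \<open>b + scale (u + v) c\<close>; differencing two of these removes
  \<open>b\<close>.\<close>

lemma quadratic_eq_zero_imp_coeffs_zero: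
  assumes "r \<noteq> s" "r \<noteq> t" "s \<noteq> t"
    and eq: "\<And>u. u \<in> {r, s, t} \<Longrightarrow> a + scale u b + scale (u * u) c = 0"
  shows "a = 0" "b = 0" "c = 0"
proof -
  have *: "b + scale (u + v) c = 0" if "u \<in> {r, s, t}" "v \<in> {r, s, t}" "u \<noteq> v" for u v
  proof -
    have "scale (u - v) (b + scale (u + v) c) =
        (a + scale u b + scale (u * u) c) - (a + scale v b + scale (v * v) c)"
      by (simp add: algebra_simps scale_left_distrib scale_right_distrib
          scale_left_diff_distrib)
    also have "\<dots> = 0"
      using eq that by simp
    finally show ?thesis
      using \<open>u \<noteq> v\<close> by simp
  qed
  have "scale (s - t) c = (b + scale (r + s) c) - (b + scale (r + t) c)"
    by (simp add: scale_left_distrib scale_left_diff_distrib)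
  also have "\<dots> = 0"
    using * assms by simp
  finally show c: "c = 0"
    using assms by simp
  show b: "b = 0"
    using *[of r s] assms c by simp
  show "a = 0"
    using eq[of r] b c by simp
qed

end

lemmas linear_map_add = module_hom.add[OF Vector_Spaces.linear.axioms(3)]
lemmas linear_map_scale = module_hom.scale[OF Vector_Spaces.linear.axioms(3)]

lemma mem_peirce_iff:
  assumes "E * E = E" "F * F = F"
  shows "A \<in> peirce E F \<longleftrightarrow> E * A = A \<and> A * F = A"
  unfolding peirce_def using assms
  by (auto simp: mult.assoc) (metis mult.assoc)+

section \<open>The Jordan defect\<close>

context unital_bimodule
begin

notation lact (infixr "\<rhd>" 74)
notation ract (infixl "\<lhd>" 75)

lemma lact_zero_left [simp]: "0 \<rhd> m = 0"
  using lact_add_left[of 0 0 m] by simp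

lemma lact_zero_right [simp]: "a \<rhd> 0 = 0"
  using lact_add_right[of a 0 0] by simp

lemma ract_zero_left [simp]: "0 \<lhd> a = 0"
  using ract_add_left[of 0 0 a] by simp

lemma ract_zero_right [simp]: "m \<lhd> 0 = 0"
  using ract_add_right[of m 0 0] by simp

lemma lact_diff_left: "(a - b) \<rhd> m = a \<rhd> m - b \<rhd> m"
  using lact_add_left[of "a - b" b m] by (simp add: algebra_simps)

lemma lact_diff_right: "a \<rhd> (m - n) = a \<rhd> m - a \<rhd> n"
  using lact_add_right[of a "m - n" n] by (simp add: algebra_simps)

lemma ract_diff_left: "(m - n) \<lhd> a = m \<lhd> a - n \<lhd> a"
  using ract_add_left[of "m - n" n a] by (simp add: algebra_simps)

lemma ract_diff_right: "m \<lhd> (a - b) = m \<lhd> a - m \<lhd> b"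
  using ract_add_right[of m "a - b" b] by (simp add: algebra_simps)

lemmas act_distribs =
  lact_add_left lact_add_right ract_add_left ract_add_right
  lact_diff_left lact_diff_right ract_diff_left ract_diff_right

lemmas act_assocs = lact_assoc[symmetric] ract_assoc[symmetric] lact_ract_assoc

lemmas act_scales = lact_scale_left lact_scale_right ract_scale_left ract_scale_right

lemma mem_peirce_bimod_iff:
  assumes "E * E = E" "F * F = F"
  shows "m \<in> peirce_bimod lact ract E F \<longleftrightarrow> E \<rhd> m = m \<and> m \<lhd> F = m"
  unfolding peirce_bimod_def using assms
  by (auto simp: act_assocs) (metis lact_ract_assoc)

lemma add_self_eq_zero_imp:
  assumes "(2::'f) \<noteq> 0" "(m::'m) + m = 0"
  shows "m = 0"
proof -
  have "scaleM 2 m = m + m"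
    using M.scale_left_distrib[of 1 1 m] by simp
  then show ?thesis
    using assms M.scale_eq_0_iff by metis
qed

definition jordan_defect :: "('a \<Rightarrow> 'm) \<Rightarrow> 'a \<Rightarrow> 'a \<Rightarrow> 'm" where
  "jordan_defect D A B =
     D (A * B + B * A) - (D A \<lhd> B + A \<rhd> D B + D B \<lhd> A + B \<rhd> D A)"

lemma jordan_derivable_at_iff_defect:
  "jordan_derivable_at lact ract D C \<longleftrightarrow> (\<forall>A B. A * B = C \<longrightarrow> jordan_defect D A B = 0)"
  by (simp add: jordan_derivable_at_def jordan_defect_def)

lemma jordan_defect_eq_0_iff:
  "jordan_defect D A B = 0 \<longleftrightarrow>
    D A \<lhd> B + A \<rhd> D B + D B \<lhd> A + B \<rhd> D A = D (A * B + B * A)"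
  by (auto simp: jordan_defect_def)

text \<open>When the Jordan products agree, the values of \<open>D\<close> on them cancel. This
  applies to \<open>J(AW, B) = J(A, WB)\<close>, where both Jordan products equal
  \<open>AWB\<close>.\<close>

lemma jordan_defect_eq_iff:
  assumes "A * B + B * A = A' * B' + B' * A'"
  shows "jordan_defect D A B = jordan_defect D A' B' \<longleftrightarrow>
    D A \<lhd> B + A \<rhd> D B + D B \<lhd> A + B \<rhd> D A =
    D A' \<lhd> B' + A' \<rhd> D B' + D B' \<lhd> A' + B' \<rhd> D A'"
  by (simp only: jordan_defect_def assms diff_conv_add_uminus add_left_cancel neg_equal_iff_equal)

text \<open>An inner derivation satisfies the product rule for every pair, so its own defect is
  zero. Every identity for \<open>J\<close> thus survives the normalization of
  \<open>D\<close>.\<close>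

lemma jordan_defect_diff_inner:
  "jordan_defect (\<lambda>A. D A - (N \<lhd> A - A \<rhd> N)) A B = jordan_defect D A B"
  by (simp add: jordan_defect_def act_distribs act_assocs algebra_simps)

lemma linear_inner: "Vector_Spaces.linear scaleA scaleM (\<lambda>A. N \<lhd> A - A \<rhd> N)"
  by unfold_locales (simp_all add: act_distribs act_scales M.scale_right_diff_distrib algebra_simps)

context
  fixes D
  assumes linear_D: "Vector_Spaces.linear scaleA scaleM D"
begin

lemmas linear_D_add = linear_map_add[OF linear_D]
lemmas linear_D_scale = linear_map_scale[OF linear_D]

lemma jordan_defect_add_left:
  "jordan_defect D (A + A') B = jordan_defect D A B + jordan_defect D A' B"
  by (simp add: jordan_defect_def linear_D_add distrib_left distrib_right act_distribs)

lemma jordan_defect_add_right: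
  "jordan_defect D A (B + B') = jordan_defect D A B + jordan_defect D A B'"
  by (simp add: jordan_defect_def linear_D_add distrib_left distrib_right act_distribs)

lemma jordan_defect_scale_left:
  "jordan_defect D (scaleA c A) B = scaleM c (jordan_defect D A B)"
  by (simp add: jordan_defect_def linear_D_add linear_D_scale act_scales scale_mult_left
      scale_mult_right M.scale_right_distrib M.scale_right_diff_distrib)

lemma jordan_defect_scale_right:
  "jordan_defect D A (scaleA c B) = scaleM c (jordan_defect D A B)"
  by (simp add: jordan_defect_def linear_D_add linear_D_scale act_scales scale_mult_left
      scale_mult_right M.scale_right_distrib M.scale_right_diff_distrib)

lemmas jordan_defect_bilinear =
  jordan_defect_add_left jordan_defect_add_right
  jordan_defect_scale_left jordan_defect_scale_right

lemma jordan_defect_zero_left: "jordan_defect D 0 B = 0"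
  using jordan_defect_scale_left[of 0 0 B] by simp

lemma jordan_defect_zero_right: "jordan_defect D A 0 = 0"
  using jordan_defect_scale_right[of A 0 0] by simp

lemma jordan_defect_minus_left: "jordan_defect D (- A) B = - jordan_defect D A B"
  using jordan_defect_add_left[of A "- A" B]
  by (simp add: jordan_defect_zero_left eq_neg_iff_add_eq_0 add.commute)

lemma jordan_defect_minus_right: "jordan_defect D A (- B) = - jordan_defect D A B"
  using jordan_defect_add_right[of A B "- B"]
  by (simp add: jordan_defect_zero_right eq_neg_iff_add_eq_0 add.commute)

text \<open>Multiplying the hypothesis by \<open>t\<close> gives
  \<open>J(V, U) + t (J(X, U) + J(V, Y)) + t^2 J(X, Y) = 0\<close>, a quadratic vanishing at three
  distinct scalars.\<close>

lemma jordan_defect_scaling_coeffs: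
  assumes "infinite (UNIV :: 'f set) \<or> card (UNIV :: 'f set) \<ge> 4"
    and zero: "\<And>t. t \<noteq> 0 \<Longrightarrow>
      jordan_defect D (scaleA t X + V) (scaleA (inverse t) U + Y) = 0"
  shows "jordan_defect D X Y = 0"
    and "jordan_defect D X U + jordan_defect D V Y = 0"
    and "jordan_defect D V U = 0"
proof -
  obtain r s t :: 'f where
    ne: "r \<noteq> 0" "s \<noteq> 0" "t \<noteq> 0" and dist: "r \<noteq> s" "r \<noteq> t" "s \<noteq> t"
    using ex_three_distinct_nonzero[OF assms(1)] by blast
  have "jordan_defect D V U + scaleM u (jordan_defect D X U + jordan_defect D V Y)
      + scaleM (u * u) (jordan_defect D X Y) = 0" if "u \<in> {r, s, t}" for u
  proof -
    have u: "u \<noteq> 0"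
      using that ne by auto
    have "scaleM u (jordan_defect D (scaleA u X + V) (scaleA (inverse u) U + Y)) =
      jordan_defect D V U + scaleM u (jordan_defect D X U + jordan_defect D V Y)
        + scaleM (u * u) (jordan_defect D X Y)"
      using u by (simp add: jordan_defect_bilinear M.scale_right_distrib algebra_simps)
    then show ?thesis
      using zero[OF u] by simp
  qed
  from M.quadratic_eq_zero_imp_coeffs_zero[OF dist this]
  show "jordan_defect D X Y = 0"
    and "jordan_defect D X U + jordan_defect D V Y = 0"
    and "jordan_defect D V U = 0"
    by auto
qed

end

end

section \<open>Peirce calculus in the algebra and the bimodule\<close>

locale peirce_bimodule = unital_bimodule scaleA scaleM lact ract
  for scaleA :: "'f::field \<Rightarrow> 'a::ring_1 \<Rightarrow> 'a"
    and scaleM :: "'f \<Rightarrow> 'm::ab_group_add \<Rightarrow> 'm"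
    and lact (infixr "\<rhd>" 74)
    and ract (infixl "\<lhd>" 75) +
  fixes P Q :: 'a
  assumes PP [simp]: "P * P = P"
    and Q_eq: "Q = 1 - P"
begin

lemma PQ [simp]: "P * Q = 0"
  and QP [simp]: "Q * P = 0"
  and QQ [simp]: "Q * Q = Q"
  by (simp_all add: Q_eq algebra_simps)

lemma P_plus_Q: "P + Q = 1"
  by (simp add: Q_eq)

lemma idem_orth_act:
  "P \<rhd> P \<rhd> m = P \<rhd> m" "Q \<rhd> P \<rhd> m = 0" "P \<rhd> Q \<rhd> m = 0" "Q \<rhd> Q \<rhd> m = Q \<rhd> m"
  "m \<lhd> P \<lhd> P = m \<lhd> P" "m \<lhd> P \<lhd> Q = 0" "m \<lhd> Q \<lhd> P = 0" "m \<lhd> Q \<lhd> Q = m \<lhd> Q"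
  by (simp_all flip: lact_assoc ract_assoc)

lemma mem_PP: "A \<in> peirce P P \<longleftrightarrow> P * A = A \<and> A * P = A"
  and mem_PQ: "A \<in> peirce P Q \<longleftrightarrow> P * A = A \<and> A * Q = A"
  and mem_QQ: "A \<in> peirce Q Q \<longleftrightarrow> Q * A = A \<and> A * Q = A"
  by (simp_all add: mem_peirce_iff)

lemma mem_MPP: "m \<in> peirce_bimod lact ract P P \<longleftrightarrow> P \<rhd> m = m \<and> m \<lhd> P = m"
  and mem_MQQ: "m \<in> peirce_bimod lact ract Q Q \<longleftrightarrow> Q \<rhd> m = m \<and> m \<lhd> Q = m"
  by (simp_all add: mem_peirce_bimod_iff)

lemma orth_of_absorb:
  "P * A = A \<Longrightarrow> Q * A = 0" "Q * A = A \<Longrightarrow> P * A = 0"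
  "A * P = A \<Longrightarrow> A * Q = 0" "A * Q = A \<Longrightarrow> A * P = 0"
  by (simp_all add: Q_eq algebra_simps)

lemma orth_of_absorb_act:
  "P \<rhd> m = m \<Longrightarrow> Q \<rhd> m = 0" "Q \<rhd> m = m \<Longrightarrow> P \<rhd> m = 0"
  "m \<lhd> P = m \<Longrightarrow> m \<lhd> Q = 0" "m \<lhd> Q = m \<Longrightarrow> m \<lhd> P = 0"
  by (simp_all add: Q_eq act_distribs lact_one ract_one)

lemma lact_eq_zero_of_orth:
  "A * E = A \<Longrightarrow> E \<rhd> m = 0 \<Longrightarrow> A \<rhd> m = 0"
  using lact_assoc[of A E m] by simp

lemma ract_eq_zero_of_orth:
  "E * A = A \<Longrightarrow> m \<lhd> E = 0 \<Longrightarrow> m \<lhd> A = 0"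
  using ract_assoc[of m E A] by simp

lemma mult_eq_zero_of_orth:
  "(A::'a) * E = A \<Longrightarrow> E * B = 0 \<Longrightarrow> A * B = 0"
  using mult.assoc[of A E B] by simp

lemma peirce_bimod_decomp: "m = P \<rhd> m \<lhd> P + P \<rhd> m \<lhd> Q + Q \<rhd> m \<lhd> P + Q \<rhd> m \<lhd> Q"
proof -
  have "m = (P + Q) \<rhd> m \<lhd> (P + Q)"
    by (simp add: P_plus_Q lact_one ract_one)
  then show ?thesis
    by (simp only: act_distribs ac_simps)
qed

end

section \<open>Defect identities from factorizations of \<open>C\<close>\<close>

text \<open>The cross terms \<open>XY\<close>, \<open>WX'\<close> and \<open>Y'X'\<close> vanish by
  orthogonality of \<open>P\<close> and \<open>Q\<close>, and the two occurrences of
  \<open>WY\<close> cancel. What remains is \<open>PC + QCQ\<close>, which is \<open>C\<close>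
  because \<open>QCP = 0\<close>. The scalar \<open>t\<close> is absorbed into \<open>X\<close> and
  \<open>X'\<close>.\<close>

lemma (in peirce_bimodule) triangular_factorization:
  assumes "Q * C * P = 0"
    and X: "X \<in> peirce P P" "X' \<in> peirce P P" "X * X' = P"
    and Y: "Y \<in> peirce Q Q" "Y' \<in> peirce Q Q" "Y' * Y = Q"
    and W: "W \<in> peirce P Q"
  shows "(X + (W + Q * C * Y')) * (X' * (C - W * Y) + Y) = C"
proof -
  note mem = X(1,2)[unfolded mem_PP] Y(1,2)[unfolded mem_QQ] W[unfolded mem_PQ]
  have XY: "X * Y = 0" and WX': "W * X' = 0" and YX': "Y' * X' = 0"
    using mem by (auto intro: mult_eq_zero_of_orth orth_of_absorb)
  have QCQ: "Q * C * Q = Q * C"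
    using assms(1) by (simp add: Q_eq algebra_simps)
  have "(X + (W + Q * C * Y')) * (X' * (C - W * Y) + Y) =
      (X * X') * (C - W * Y) + X * Y + (W * X') * (C - W * Y) + W * Y
      + Q * C * (Y' * X') * (C - W * Y) + Q * C * (Y' * Y)"
    by (simp add: algebra_simps)
  also have "\<dots> = P * C - P * W * Y + W * Y + Q * C * Q"
    using X(3) Y(3) XY WX' YX' by (simp add: algebra_simps)
  also have "\<dots> = P * C + Q * C"
    using mem QCQ by simp
  also have "\<dots> = C"
    by (simp add: P_plus_Q flip: distrib_right)
  finally show ?thesis .
qed

lemma (in unital_algebra) corner_units_scale:
  assumes "t \<noteq> 0" "X \<in> peirce E E" "X' \<in> peirce E E" "X * X' = E"
  shows "scale t X \<in> peirce E E" "scale (inverse t) X' \<in> peirce E E"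
    "scale t X * scale (inverse t) X' = E"
proof -
  have "scale c (E * A * E) = E * scale c A * E" for c A
    by (simp add: scale_mult_left scale_mult_right)
  then show "scale t X \<in> peirce E E" "scale (inverse t) X' \<in> peirce E E"
    using assms(2,3) unfolding peirce_def by blast+
  show "scale t X * scale (inverse t) X' = E"
    using assms(1,4) by (simp add: scale_mult_left scale_mult_right)
qed

locale jordan_derivable_peirce = peirce_bimodule scaleA scaleM lact ract P Q
  for scaleA :: "'f::field \<Rightarrow> 'a::ring_1 \<Rightarrow> 'a"
    and scaleM :: "'f \<Rightarrow> 'm::ab_group_add \<Rightarrow> 'm"
    and lact (infixr "\<rhd>" 74)
    and ract (infixl "\<lhd>" 75)
    and P Q +
  fixes C :: 'a and D :: "'a \<Rightarrow> 'm"
  assumes two_neq_zero: "(2::'f) \<noteq> 0"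
    and card_field: "infinite (UNIV :: 'f set) \<or> card (UNIV :: 'f set) \<ge> 4"
    and span_PP: "\<forall>A \<in> peirce P P. A \<in> span (corner_units P)"
    and span_QQ: "\<forall>A \<in> peirce Q Q. A \<in> span (corner_units Q)"
    and QCP: "Q * C * P = 0"
    and linear_D: "Vector_Spaces.linear scaleA scaleM D"
    and derivable: "jordan_derivable_at lact ract D C"
begin

abbreviation J where "J \<equiv> jordan_defect D"

lemmas J_bilinear = jordan_defect_bilinear[OF linear_D]
lemmas J_zero = jordan_defect_zero_left[OF linear_D] jordan_defect_zero_right[OF linear_D]
lemmas J_minus = jordan_defect_minus_left[OF linear_D] jordan_defect_minus_right[OF linear_D]

text \<open>The three coefficients in \<open>t\<close> for \<open>V = W + QCY'\<close> and
  \<open>U = X'(C - WY)\<close>. The last two still contain \<open>C\<close>; since \<open>W\<close>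
  is free, comparing different choices of \<open>W\<close> eliminates it.\<close>

lemma J_unit_coeffs:
  assumes X: "X \<in> peirce P P" "X' \<in> peirce P P" "X * X' = P"
    and Y: "Y \<in> peirce Q Q" "Y' \<in> peirce Q Q" "Y' * Y = Q"
    and W: "W \<in> peirce P Q"
  shows "J X Y = 0"
    and "J X (X' * (C - W * Y)) + J (W + Q * C * Y') Y = 0"
    and "J (W + Q * C * Y') (X' * (C - W * Y)) = 0"
proof -
  have "J (scaleA t X + (W + Q * C * Y')) (scaleA (inverse t) (X' * (C - W * Y)) + Y) = 0"
    if "t \<noteq> 0" for t
    using triangular_factorization[OF QCP corner_units_scale[OF that X] Y W] derivable
    unfolding jordan_derivable_at_iff_defect by (simp add: scale_mult_left)
  from jordan_defect_scaling_coeffs[OF linear_D card_field this]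
  show "J X Y = 0"
    and "J X (X' * (C - W * Y)) + J (W + Q * C * Y') Y = 0"
    and "J (W + Q * C * Y') (X' * (C - W * Y)) = 0"
    by auto
qed

lemma zero_mem_PQ: "0 \<in> peirce P Q"
  by (simp add: mem_PQ)

lemma J_units:
  assumes "X \<in> corner_units P" "Y \<in> corner_units Q"
  shows "J X Y = 0"
  using assms J_unit_coeffs(1)[OF _ _ _ _ _ _ zero_mem_PQ]
  unfolding corner_units_def by blast

text \<open>The middle coefficient is taken at \<open>XW\<close> and at 0. Subtracting the two
  instances removes both terms containing \<open>C\<close>.\<close>

lemma J_units_balanced:
  assumes XU: "X \<in> corner_units P" and YU: "Y \<in> corner_units Q" and W: "W \<in> peirce P Q"
  shows "J (X * W) Y = J X (W * Y)"
proof -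
  obtain X' where X: "X \<in> peirce P P" "X' \<in> peirce P P" "X * X' = P" and X'X: "X' * X = P"
    using XU unfolding corner_units_def by blast
  obtain Y' where Y: "Y \<in> peirce Q Q" "Y' \<in> peirce Q Q" "Y' * Y = Q"
    using YU unfolding corner_units_def by blast
  \<comment> \<open>Using \<open>XW\<close> in place of \<open>W\<close> lets \<open>X'X = P\<close>
    reduce \<open>X'(XW)Y\<close> to \<open>WY\<close>; here \<open>X'\<close> serves as a left
    inverse as well.\<close>
  have XW: "X * W \<in> peirce P Q"
    using X(1) W by (metis mem_PP mem_PQ mult.assoc)
  have "X' * (C - X * W * Y) = X' * C - (X' * X) * W * Y"
    by (simp add: algebra_simps)
  also have "\<dots> = X' * C - W * Y"
    using X'X W by (simp add: mem_PQ)
  finally have "J X (X' * C - W * Y) + J (X * W + Q * C * Y') Y = 0"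
    using J_unit_coeffs(2)[OF X Y XW] by simp
  moreover have "J (Q * C * Y') Y = - J X (X' * C)"
    using J_unit_coeffs(2)[OF X Y zero_mem_PQ] by (simp add: minus_unique)
  moreover have "J X (X' * C - W * Y) = J X (X' * C) - J X (W * Y)"
    using J_bilinear(2)[of X "X' * C" "- (W * Y)"] by (simp add: J_minus)
  ultimately show ?thesis
    by (simp add: J_bilinear algebra_simps)
qed

lemma J_diag:
  assumes "A \<in> peirce P P" "B \<in> peirce Q Q"
  shows "J A B = 0"
proof -
  \<comment> \<open>Bilinearity is used one argument at a time: first \<open>A\<close> runs over the
    span with \<open>B\<close> a unit, then \<open>B\<close> does.\<close>
  have units: "J A B = 0" if "B \<in> corner_units Q" for B
    using span_PP[rule_format, OF assms(1)]
  proof (induction rule: span_induct)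
    case base
    show ?case
      by (auto intro!: subspaceI simp: J_bilinear J_zero)
  next
    case (step X)
    then show ?case
      using J_units that by simp
  qed
  show ?thesis
    using span_QQ[rule_format, OF assms(2)]
  proof (induction rule: span_induct)
    case base
    show ?case
      by (auto intro!: subspaceI simp: J_bilinear J_zero)
  next
    case (step X)
    then show ?case
      using units by simp
  qed
qed

lemma J_balanced:
  assumes "A \<in> peirce P P" "B \<in> peirce Q Q" and W: "W \<in> peirce P Q"
  shows "J (A * W) B = J A (W * B)"
proof -
  have units: "J (A * W) B = J A (W * B)" if "B \<in> corner_units Q" for B
    using span_PP[rule_format, OF assms(1)]
  proof (induction rule: span_induct)
    case base
    show ?case
      by (auto intro!: subspaceI simp: J_bilinear J_zero distrib_right scale_mult_left)
  next
    case (step X)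
    then show ?case
      using J_units_balanced that W by simp
  qed
  show ?thesis
    using span_QQ[rule_format, OF assms(2)]
  proof (induction rule: span_induct)
    case base
    show ?case
      by (auto intro!: subspaceI simp: J_bilinear J_zero distrib_left scale_mult_right)
  next
    case (step X)
    then show ?case
      using units by simp
  qed
qed

text \<open>Take \<open>X = P\<close> and \<open>Y = Q\<close> in the last coefficient. Adding its
  instances at \<open>W\<close> and \<open>- W\<close> cancels the terms linear in \<open>W\<close>;
  the instance at 0 removes the constant term \<open>J(QCQ, PC)\<close>, leaving
  \<open>2 J(W, W) = 0\<close>.\<close>

lemma J_square:
  assumes W: "W \<in> peirce P Q"
  shows "J W W = 0"
proof -
  have P: "P \<in> peirce P P" and Q: "Q \<in> peirce Q Q"
    by (simp_all add: mem_PP mem_QQ)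
  have minus_W: "- W \<in> peirce P Q"
    using W by (simp add: mem_PQ)
  have WQ: "W * Q = W" and PW: "P * W = W"
    using W by (simp_all add: mem_PQ)
  note coeff = J_unit_coeffs(3)[OF P P PP Q Q QQ]
  have "J (W + Q * C * Q) (P * C + - W) = 0"
    using coeff[OF W] WQ PW by (simp add: algebra_simps)
  moreover have "J (- W + Q * C * Q) (P * C + W) = 0"
    using coeff[OF minus_W] WQ PW by (simp add: algebra_simps)
  moreover have "J (Q * C * Q) (P * C) = 0"
    using coeff[OF zero_mem_PQ] by simp
  ultimately have "J W W + J W W = 0"
    by (simp only: J_bilinear J_minus)
      (simp add: algebra_simps eq_neg_iff_add_eq_0 neg_eq_iff_add_eq_0)
  then show ?thesis
    using add_self_eq_zero_imp two_neq_zero by blast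
qed

end

section \<open>Peirce components of the identities\<close>

text \<open>Everything retained of derivability at \<open>C\<close> once \<open>C\<close> is
  eliminated, together with the normalization that \<open>\<delta> P\<close> and
  \<open>\<delta> Q\<close> lie in the diagonal corners.\<close>

locale peirce_jordan_identities = peirce_bimodule scaleA scaleM lact ract P Q
  for scaleA :: "'f::field \<Rightarrow> 'a::ring_1 \<Rightarrow> 'a"
    and scaleM :: "'f \<Rightarrow> 'm::ab_group_add \<Rightarrow> 'm"
    and lact (infixr "\<rhd>" 74)
    and ract (infixl "\<lhd>" 75)
    and P Q +
  fixes \<delta> :: "'a \<Rightarrow> 'm"
  assumes two_neq_zero: "(2::'f) \<noteq> 0"
    and linear: "Vector_Spaces.linear scaleA scaleM \<delta>"
    and diag: "\<lbrakk>A \<in> peirce P P; B \<in> peirce Q Q\<rbrakk> \<Longrightarrow> jordan_defect \<delta> A B = 0"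
    and balanced: "\<lbrakk>A \<in> peirce P P; B \<in> peirce Q Q; W \<in> peirce P Q\<rbrakk> \<Longrightarrow>
      jordan_defect \<delta> (A * W) B = jordan_defect \<delta> A (W * B)"
    and square: "W \<in> peirce P Q \<Longrightarrow> jordan_defect \<delta> W W = 0"
    and \<delta>P_mem: "\<delta> P \<in> peirce_bimod lact ract P P"
    and \<delta>Q_mem: "\<delta> Q \<in> peirce_bimod lact ract Q Q"
begin

lemma P_mem: "P \<in> peirce P P" and Q_mem: "Q \<in> peirce Q Q"
  by (simp_all add: mem_PP mem_QQ)

lemma \<delta>P [simp]: "P \<rhd> \<delta> P = \<delta> P" "\<delta> P \<lhd> P = \<delta> P" "Q \<rhd> \<delta> P = 0" "\<delta> P \<lhd> Q = 0"
  and \<delta>Q [simp]: "Q \<rhd> \<delta> Q = \<delta> Q" "\<delta> Q \<lhd> Q = \<delta> Q" "P \<rhd> \<delta> Q = 0" "\<delta> Q \<lhd> P = 0"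
  using \<delta>P_mem \<delta>Q_mem by (auto simp: mem_MPP mem_MQQ orth_of_absorb_act)

lemma \<delta>_zero [simp]: "\<delta> 0 = 0"
  using linear_map_scale[OF linear, of 0 0] by simp

text \<open>Compressing by \<open>E\<close> on both sides gives \<open>2 EmE = 0\<close>;
  multiplying by \<open>E\<close> on the left alone then leaves \<open>Em = 0\<close>.\<close>

lemma idem_anticommute_imp_zero:
  assumes "E * E = E" "m \<lhd> E + E \<rhd> m = 0"
  shows "E \<rhd> m = 0" "m \<lhd> E = 0"
proof -
  have idem: "E \<rhd> E \<rhd> x = E \<rhd> x" "x \<lhd> E \<lhd> E = x \<lhd> E" for x
    using assms(1) by (simp_all flip: lact_assoc ract_assoc)
  have "E \<rhd> (m \<lhd> E + E \<rhd> m) \<lhd> E = 0"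
    using assms by simp
  then have "E \<rhd> m \<lhd> E + E \<rhd> m \<lhd> E = 0"
    by (simp add: act_distribs idem lact_ract_assoc)
  then have E: "E \<rhd> m \<lhd> E = 0"
    using add_self_eq_zero_imp two_neq_zero by blast
  have "E \<rhd> (m \<lhd> E + E \<rhd> m) = 0"
    using assms by simp
  then show "E \<rhd> m = 0"
    using E by (simp add: act_distribs idem)
  then show "m \<lhd> E = 0"
    using assms(2) by simp
qed

text \<open>In \<open>J(A, Q) = 0\<close> the products \<open>AQ\<close>, \<open>QA\<close>,
  \<open>A \<delta>(Q)\<close> and \<open>\<delta>(Q) A\<close> all vanish, so
  \<open>\<delta>(A)\<close> anticommutes with the idempotent \<open>Q\<close>.\<close>

lemma \<delta>_PP:
  assumes "A \<in> peirce P P"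
  shows "P \<rhd> \<delta> A = \<delta> A" "\<delta> A \<lhd> P = \<delta> A" "Q \<rhd> \<delta> A = 0" "\<delta> A \<lhd> Q = 0"
proof -
  have A: "P * A = A" "A * P = A" "A * Q = 0" "Q * A = 0"
    using assms by (auto simp: mem_PP orth_of_absorb)
  have "A \<rhd> \<delta> Q = 0" "\<delta> Q \<lhd> A = 0"
    using A lact_eq_zero_of_orth ract_eq_zero_of_orth \<delta>Q by blast+
  then have "\<delta> A \<lhd> Q + Q \<rhd> \<delta> A = 0"
    using diag[OF assms Q_mem] A by (simp add: jordan_defect_eq_0_iff)
  then show Q: "Q \<rhd> \<delta> A = 0" "\<delta> A \<lhd> Q = 0"
    using idem_anticommute_imp_zero QQ by blast+
  then show "P \<rhd> \<delta> A = \<delta> A" "\<delta> A \<lhd> P = \<delta> A"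
    by (simp_all add: Q_eq act_distribs lact_one ract_one)
qed

lemma \<delta>_QQ:
  assumes "A \<in> peirce Q Q"
  shows "Q \<rhd> \<delta> A = \<delta> A" "\<delta> A \<lhd> Q = \<delta> A" "P \<rhd> \<delta> A = 0" "\<delta> A \<lhd> P = 0"
proof -
  have A: "Q * A = A" "A * Q = A" "A * P = 0" "P * A = 0"
    using assms by (auto simp: mem_QQ orth_of_absorb)
  have "A \<rhd> \<delta> P = 0" "\<delta> P \<lhd> A = 0"
    using A lact_eq_zero_of_orth ract_eq_zero_of_orth \<delta>P by blast+
  then have "\<delta> A \<lhd> P + P \<rhd> \<delta> A = 0"
    using diag[OF P_mem assms] A by (simp add: jordan_defect_eq_0_iff add.commute)
  then show P: "P \<rhd> \<delta> A = 0" "\<delta> A \<lhd> P = 0"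
    using idem_anticommute_imp_zero PP by blast+
  then show "Q \<rhd> \<delta> A = \<delta> A" "\<delta> A \<lhd> Q = \<delta> A"
    by (simp_all add: Q_eq act_distribs lact_one ract_one)
qed

text \<open>All three claims are components of \<open>J(W, Q) = J(P, W)\<close>: (1,2) gives the
  first, (1,1) and (2,2) the others. The (2,1) component is a tautology, so
  \<open>Q \<delta>(W) P\<close> may survive.\<close>

lemma \<delta>_PQ:
  assumes W: "W \<in> peirce P Q"
  shows "\<delta> P \<lhd> W = W \<rhd> \<delta> Q"
    and "P \<rhd> \<delta> W \<lhd> P = 0" "Q \<rhd> \<delta> W \<lhd> Q = 0"
proof -
  have Wm: "P * W = W" "W * Q = W" "Q * W = 0" "W * P = 0"
    using W by (auto simp: mem_PQ orth_of_absorb)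
  have zero: "W \<rhd> \<delta> P = 0" "\<delta> Q \<lhd> W = 0"
    using Wm lact_eq_zero_of_orth ract_eq_zero_of_orth \<delta>P \<delta>Q by blast+
  have comp: "P \<rhd> W \<rhd> m = W \<rhd> m" "Q \<rhd> W \<rhd> m = 0" "m \<lhd> W \<lhd> Q = m \<lhd> W" "m \<lhd> W \<lhd> P = 0" for m
    using Wm by (simp_all flip: lact_assoc ract_assoc)
  have "P \<rhd> \<delta> P \<lhd> W = \<delta> P \<lhd> W"
    by (simp flip: lact_ract_assoc)
  note rules = zero comp idem_orth_act this act_distribs lact_ract_assoc
  have eq: "\<delta> W \<lhd> Q + W \<rhd> \<delta> Q + Q \<rhd> \<delta> W = \<delta> P \<lhd> W + P \<rhd> \<delta> W + \<delta> W \<lhd> P"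
    using balanced[OF P_mem Q_mem W] Wm zero by (simp add: jordan_defect_eq_iff add.assoc)
  have PP_part: "P \<rhd> (\<delta> W \<lhd> Q + W \<rhd> \<delta> Q + Q \<rhd> \<delta> W) \<lhd> P =
      P \<rhd> (\<delta> P \<lhd> W + P \<rhd> \<delta> W + \<delta> W \<lhd> P) \<lhd> P"
    and QQ_part: "Q \<rhd> (\<delta> W \<lhd> Q + W \<rhd> \<delta> Q + Q \<rhd> \<delta> W) \<lhd> Q =
      Q \<rhd> (\<delta> P \<lhd> W + P \<rhd> \<delta> W + \<delta> W \<lhd> P) \<lhd> Q"
    and PQ_part: "P \<rhd> (\<delta> W \<lhd> Q + W \<rhd> \<delta> Q + Q \<rhd> \<delta> W) \<lhd> Q =
      P \<rhd> (\<delta> P \<lhd> W + P \<rhd> \<delta> W + \<delta> W \<lhd> P) \<lhd> Q"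
    by (simp_all only: eq)
  have "P \<rhd> \<delta> W \<lhd> P + P \<rhd> \<delta> W \<lhd> P = 0"
    using PP_part by (simp add: rules)
  then show "P \<rhd> \<delta> W \<lhd> P = 0"
    using add_self_eq_zero_imp two_neq_zero by blast
  have "Q \<rhd> \<delta> P \<lhd> W = 0"
    by (simp flip: lact_ract_assoc)
  then have "Q \<rhd> \<delta> W \<lhd> Q + Q \<rhd> \<delta> W \<lhd> Q = 0"
    using QQ_part by (simp add: rules)
  then show "Q \<rhd> \<delta> W \<lhd> Q = 0"
    using add_self_eq_zero_imp two_neq_zero by blast
  show "\<delta> P \<lhd> W = W \<rhd> \<delta> Q"
    using PQ_part by (simp add: rules)
qed

text \<open>Since \<open>WW = 0\<close>, the identity \<open>J(W, W) = 0\<close> only says that the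
  two products sum to zero. Right multiplication by \<open>Q\<close> separates them: it fixes
  \<open>\<delta>(W) W\<close> and kills \<open>W \<delta>(W)\<close>, as \<open>\<delta>(W)\<close>
  has no (2,2) component.\<close>

lemma \<delta>_PQ_annihilates:
  assumes W: "W \<in> peirce P Q"
  shows "W \<rhd> \<delta> W = 0" "\<delta> W \<lhd> W = 0"
proof -
  have Wm: "P * W = W" "W * Q = W" "Q * W = 0" "W * P = 0"
    using W by (auto simp: mem_PQ orth_of_absorb)
  have WW: "W * W = 0"
    using Wm mult_eq_zero_of_orth by blast
  have "(\<delta> W \<lhd> W + W \<rhd> \<delta> W) + (\<delta> W \<lhd> W + W \<rhd> \<delta> W) = 0"
    using square[OF W] WW by (simp add: jordan_defect_eq_0_iff ac_simps)
  then have sum: "\<delta> W \<lhd> W + W \<rhd> \<delta> W = 0"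
    using add_self_eq_zero_imp two_neq_zero by blast
  have "W \<rhd> \<delta> W \<lhd> Q = W \<rhd> Q \<rhd> \<delta> W \<lhd> Q"
    using Wm by (simp flip: lact_assoc)
  also have "\<dots> = 0"
    using \<delta>_PQ(3)[OF W] by simp
  finally have WQ: "W \<rhd> \<delta> W \<lhd> Q = 0" .
  have "(\<delta> W \<lhd> W + W \<rhd> \<delta> W) \<lhd> Q = 0"
    using sum by simp
  then show "\<delta> W \<lhd> W = 0"
    using WQ Wm by (simp add: act_distribs lact_ract_assoc flip: ract_assoc)
  then show "W \<rhd> \<delta> W = 0"
    using sum by simp
qed

text \<open>The (1,2) component of \<open>J(AW, Q) = J(A, W)\<close>, with
  \<open>(AW) \<delta>(Q)\<close> rewritten as \<open>\<delta>(P) (AW)\<close>.\<close>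

lemma \<delta>_left_mult:
  assumes A: "A \<in> peirce P P" and W: "W \<in> peirce P Q"
  shows "P \<rhd> \<delta> (A * W) \<lhd> Q = \<delta> A \<lhd> W + A \<rhd> P \<rhd> \<delta> W \<lhd> Q - \<delta> P \<lhd> (A * W)"
proof -
  have Am: "P * A = A" "A * P = A"
    using A by (auto simp: mem_PP)
  have Wm: "P * W = W" "W * Q = W" "Q * W = 0" "W * P = 0"
    using W by (auto simp: mem_PQ orth_of_absorb)
  have AW: "A * W \<in> peirce P Q"
    using Am Wm by (metis mem_PQ mult.assoc)
  then have AWm: "A * W * Q = A * W" "Q * (A * W) = 0" "P * (A * W) = A * W"
    by (auto simp: mem_PQ orth_of_absorb)
  have WA: "W * A = 0"
    using Wm Am by (metis mult.assoc mult_zero_left)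
  have zero: "\<delta> Q \<lhd> (A * W) = 0"
    using AWm ract_eq_zero_of_orth \<delta>Q by blast
  have "W \<rhd> \<delta> A = 0"
    using Wm \<delta>_PP[OF A] lact_eq_zero_of_orth by blast
  then have "\<delta> (A * W) \<lhd> Q + (A * W) \<rhd> \<delta> Q + Q \<rhd> \<delta> (A * W) =
      \<delta> A \<lhd> W + A \<rhd> \<delta> W + \<delta> W \<lhd> A"
    using balanced[OF A Q_mem W] AWm Wm WA zero by (simp add: jordan_defect_eq_iff)
  then have "P \<rhd> (\<delta> (A * W) \<lhd> Q + (A * W) \<rhd> \<delta> Q + Q \<rhd> \<delta> (A * W)) \<lhd> Q =
      P \<rhd> (\<delta> A \<lhd> W + A \<rhd> \<delta> W + \<delta> W \<lhd> A) \<lhd> Q"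
    by simp
  moreover have "P \<rhd> (\<delta> (A * W) \<lhd> Q + (A * W) \<rhd> \<delta> Q + Q \<rhd> \<delta> (A * W)) \<lhd> Q =
      P \<rhd> \<delta> (A * W) \<lhd> Q + \<delta> P \<lhd> (A * W)"
  proof -
    have "P \<rhd> Q \<rhd> m = 0" "m \<lhd> Q \<lhd> Q = m \<lhd> Q" for m
      by (simp_all flip: lact_assoc ract_assoc)
    moreover have "P \<rhd> (A * W) \<rhd> \<delta> Q = (A * W) \<rhd> \<delta> Q"
      using AWm by (simp flip: lact_assoc)
    ultimately show ?thesis
      using \<delta>_PQ(1)[OF AW] by (simp add: act_distribs lact_ract_assoc)
  qed
  moreover have "P \<rhd> (\<delta> A \<lhd> W + A \<rhd> \<delta> W + \<delta> W \<lhd> A) \<lhd> Q =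
      \<delta> A \<lhd> W + A \<rhd> P \<rhd> \<delta> W \<lhd> Q"
  proof -
    have "P \<rhd> \<delta> A \<lhd> W = \<delta> A \<lhd> W"
      using \<delta>_PP[OF A] by (simp flip: lact_ract_assoc)
    moreover have "m \<lhd> W \<lhd> Q = m \<lhd> W" "P \<rhd> A \<rhd> m = A \<rhd> m" "A \<rhd> P \<rhd> m = A \<rhd> m" for m
      using Am Wm by (simp_all flip: lact_assoc ract_assoc)
    moreover have "m \<lhd> A \<lhd> Q = 0" for m
      using Am orth_of_absorb by (simp flip: ract_assoc)
    ultimately show ?thesis
      by (simp add: act_distribs lact_ract_assoc)
  qed
  ultimately show ?thesis
    by (simp add: algebra_simps)
qed

text \<open>Mirror image, from the (1,2) component of \<open>J(W, B) = J(P, WB)\<close>; this time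
  \<open>\<delta>(P) (WB)\<close> becomes \<open>(WB) \<delta>(Q)\<close>.\<close>

lemma \<delta>_right_mult:
  assumes B: "B \<in> peirce Q Q" and W: "W \<in> peirce P Q"
  shows "P \<rhd> \<delta> (W * B) \<lhd> Q = W \<rhd> \<delta> B + P \<rhd> \<delta> W \<lhd> Q \<lhd> B - (W * B) \<rhd> \<delta> Q"
proof -
  have Bm: "Q * B = B" "B * Q = B" "P * B = 0" "B * P = 0"
    using B by (auto simp: mem_QQ orth_of_absorb)
  have Wm: "P * W = W" "W * Q = W" "Q * W = 0" "W * P = 0"
    using W by (auto simp: mem_PQ orth_of_absorb)
  have WB: "W * B \<in> peirce P Q"
    using Bm Wm by (metis mem_PQ mult.assoc)
  then have WBm: "W * B * P = 0" "P * (W * B) = W * B"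
    by (auto simp: mem_PQ orth_of_absorb)
  have BW: "B * W = 0"
    using Wm Bm mult_eq_zero_of_orth by blast
  have zero: "(W * B) \<rhd> \<delta> P = 0"
    using WB \<delta>P lact_eq_zero_of_orth mem_PQ by blast
  have "\<delta> B \<lhd> W = 0"
    using Wm \<delta>_QQ[OF B] ract_eq_zero_of_orth by blast
  then have "\<delta> W \<lhd> B + W \<rhd> \<delta> B + B \<rhd> \<delta> W =
      \<delta> P \<lhd> (W * B) + P \<rhd> \<delta> (W * B) + \<delta> (W * B) \<lhd> P"
    using balanced[OF P_mem B W] WBm Wm BW zero by (simp add: jordan_defect_eq_iff)
  then have "P \<rhd> (\<delta> W \<lhd> B + W \<rhd> \<delta> B + B \<rhd> \<delta> W) \<lhd> Q =
      P \<rhd> (\<delta> P \<lhd> (W * B) + P \<rhd> \<delta> (W * B) + \<delta> (W * B) \<lhd> P) \<lhd> Q"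
    by simp
  moreover have "P \<rhd> (\<delta> P \<lhd> (W * B) + P \<rhd> \<delta> (W * B) + \<delta> (W * B) \<lhd> P) \<lhd> Q =
      P \<rhd> \<delta> (W * B) \<lhd> Q + (W * B) \<rhd> \<delta> Q"
  proof -
    have "P \<rhd> P \<rhd> m = P \<rhd> m" "m \<lhd> P \<lhd> Q = 0" for m
      by (simp_all flip: lact_assoc ract_assoc)
    moreover have "P \<rhd> (W * B) \<rhd> \<delta> Q = (W * B) \<rhd> \<delta> Q"
      using WBm by (simp flip: lact_assoc)
    ultimately show ?thesis
      using \<delta>_PQ(1)[OF WB] by (simp add: act_distribs lact_ract_assoc)
  qed
  moreover have "P \<rhd> (\<delta> W \<lhd> B + W \<rhd> \<delta> B + B \<rhd> \<delta> W) \<lhd> Q =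
      W \<rhd> \<delta> B + P \<rhd> \<delta> W \<lhd> Q \<lhd> B"
  proof -
    have "P \<rhd> W \<rhd> m = W \<rhd> m" "m \<lhd> B \<lhd> Q = m \<lhd> B" "m \<lhd> Q \<lhd> B = m \<lhd> B" "P \<rhd> B \<rhd> m = 0" for m
      using Bm Wm by (simp_all flip: lact_assoc ract_assoc)
    then show ?thesis
      using \<delta>_QQ[OF B] by (simp add: act_distribs lact_ract_assoc)
  qed
  ultimately show ?thesis
    by (simp add: algebra_simps)
qed

section \<open>Consequences of faithfulness of the (1,2) corner\<close>

lemma left_faithful_eq_zero:
  assumes "left_faithful ract P Q" "m \<lhd> P = m" "\<And>W. W \<in> peirce P Q \<Longrightarrow> m \<lhd> W = 0"
  shows "m = 0"
proof -
  \<comment> \<open>Faithfulness is phrased with equality to \<open>{0}\<close>, so the set of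
    products must also be shown nonempty.\<close>
  have "0 \<in> peirce P Q"
    by (simp add: mem_PQ)
  then have "{m \<lhd> W | W. W \<in> peirce P Q} = {0}"
    using assms(3) by force
  then have "m \<lhd> P = 0"
    by (rule assms(1)[unfolded left_faithful_def, rule_format])
  then show ?thesis
    using assms(2) by simp
qed

lemma right_faithful_eq_zero:
  assumes "right_faithful lact P Q" "Q \<rhd> m = m" "\<And>W. W \<in> peirce P Q \<Longrightarrow> W \<rhd> m = 0"
  shows "m = 0"
proof -
  have "0 \<in> peirce P Q"
    by (simp add: mem_PQ)
  then have "{W \<rhd> m | W. W \<in> peirce P Q} = {0}"
    using assms(3) by force
  then have "Q \<rhd> m = 0"
    by (rule assms(1)[unfolded right_faithful_def, rule_format])
  then show ?thesis
    using assms(2) by simp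
qed

text \<open>Against every \<open>W\<close>, both sides become \<open>AW \<delta>(Q)\<close>, by the
  intertwining relation \<open>\<delta>(P) W = W \<delta>(Q)\<close> at \<open>W\<close> and at
  \<open>AW\<close>; faithfulness cancels \<open>W\<close>.\<close>

lemma \<delta>P_commutes:
  assumes lf: "left_faithful ract P Q" and A: "A \<in> peirce P P"
  shows "A \<rhd> \<delta> P = \<delta> P \<lhd> A"
proof -
  have Am: "P * A = A" "A * P = A"
    using A by (auto simp: mem_PP)
  have "A \<rhd> \<delta> P - \<delta> P \<lhd> A = 0"
  proof (rule left_faithful_eq_zero[OF lf])
    show "(A \<rhd> \<delta> P - \<delta> P \<lhd> A) \<lhd> P = A \<rhd> \<delta> P - \<delta> P \<lhd> A"
      using Am by (simp add: act_distribs lact_ract_assoc flip: ract_assoc)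
  next
    fix W assume W: "W \<in> peirce P Q"
    then have AW: "A * W \<in> peirce P Q"
      using Am by (metis mem_PQ mult.assoc)
    have "A \<rhd> \<delta> P \<lhd> W = A \<rhd> W \<rhd> \<delta> Q"
      using \<delta>_PQ(1)[OF W] by simp
    also have "\<dots> = \<delta> P \<lhd> A \<lhd> W"
      using \<delta>_PQ(1)[OF AW] by (simp add: lact_assoc ract_assoc)
    finally show "(A \<rhd> \<delta> P - \<delta> P \<lhd> A) \<lhd> W = 0"
      by (simp add: act_distribs lact_ract_assoc)
  qed
  then show ?thesis
    by simp
qed

text \<open>Multiplied by \<open>W\<close> on the left, both sides become
  \<open>\<delta>(P) WB\<close>.\<close>

lemma \<delta>Q_commutes:
  assumes rf: "right_faithful lact P Q" and B: "B \<in> peirce Q Q"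
  shows "B \<rhd> \<delta> Q = \<delta> Q \<lhd> B"
proof -
  have Bm: "Q * B = B" "B * Q = B"
    using B by (auto simp: mem_QQ)
  have "B \<rhd> \<delta> Q - \<delta> Q \<lhd> B = 0"
  proof (rule right_faithful_eq_zero[OF rf])
    show "Q \<rhd> (B \<rhd> \<delta> Q - \<delta> Q \<lhd> B) = B \<rhd> \<delta> Q - \<delta> Q \<lhd> B"
      using Bm by (simp add: act_distribs flip: lact_assoc lact_ract_assoc)
  next
    fix W assume W: "W \<in> peirce P Q"
    then have WB: "W * B \<in> peirce P Q"
      using Bm by (metis mem_PQ mult.assoc)
    have "W \<rhd> \<delta> Q \<lhd> B = \<delta> P \<lhd> W \<lhd> B"
      using \<delta>_PQ(1)[OF W] by (simp flip: lact_ract_assoc)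
    also have "\<dots> = W \<rhd> B \<rhd> \<delta> Q"
      using \<delta>_PQ(1)[OF WB] by (simp add: lact_assoc ract_assoc)
    finally show "W \<rhd> (B \<rhd> \<delta> Q - \<delta> Q \<lhd> B) = 0"
      by (simp add: act_distribs)
  qed
  then show ?thesis
    by simp
qed

text \<open>Both product rules come from computing the \<open>(1,2)\<close> component of \<open>\<delta>\<close> on a threefold product,
  \<open>\<delta>(ABW)\<close> resp. \<open>\<delta>(WAB)\<close>, in two ways.\<close>

lemma \<delta>_mult_PP:
  assumes lf: "left_faithful ract P Q" and A: "A \<in> peirce P P" and B: "B \<in> peirce P P"
  shows "\<delta> (A * B) = \<delta> A \<lhd> B + A \<rhd> \<delta> B - \<delta> P \<lhd> A \<lhd> B"
proof -
  have m: "P * A = A" "A * P = A" "P * B = B" "B * P = B"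
    using A B by (auto simp: mem_PP)
  have AB: "A * B \<in> peirce P P"
    using m by (metis mem_PP mult.assoc)
  \<comment> \<open>The expansion of \<open>\<delta>(A(BW))\<close> produces the correction as
    \<open>A \<delta>(P) B\<close>; commutation with \<open>A\<close> turns it into
    \<open>\<delta>(P) AB\<close> only at the end.\<close>
  have "\<delta> (A * B) - \<delta> A \<lhd> B - A \<rhd> \<delta> B + A \<rhd> \<delta> P \<lhd> B = 0" (is "?m = 0")
  proof (rule left_faithful_eq_zero[OF lf])
    have "x \<lhd> B \<lhd> P = x \<lhd> B" for x
      using m by (simp flip: ract_assoc)
    then show "?m \<lhd> P = ?m"
      using \<delta>_PP[OF AB] \<delta>_PP[OF B] by (simp add: act_distribs lact_ract_assoc)
  next
    fix W assume W: "W \<in> peirce P Q"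
    have BW: "B * W \<in> peirce P Q"
      using m W by (metis mem_PQ mult.assoc)
    have "\<delta> (A * B) \<lhd> W + (A * B) \<rhd> P \<rhd> \<delta> W \<lhd> Q - \<delta> P \<lhd> (A * B * W) =
        \<delta> A \<lhd> (B * W) + A \<rhd> (\<delta> B \<lhd> W + B \<rhd> P \<rhd> \<delta> W \<lhd> Q - \<delta> P \<lhd> (B * W))
          - \<delta> P \<lhd> (A * B * W)"
      using \<delta>_left_mult[OF AB W] \<delta>_left_mult[OF A BW] \<delta>_left_mult[OF B W]
      by (simp add: mult.assoc)
    then show "?m \<lhd> W = 0"
      by (simp add: act_distribs lact_assoc ract_assoc lact_ract_assoc algebra_simps)
  qed
  then show ?thesis
    using \<delta>P_commutes[OF lf A] by (simp add: algebra_simps flip: lact_ract_assoc)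
qed

lemma \<delta>_mult_QQ:
  assumes rf: "right_faithful lact P Q" and A: "A \<in> peirce Q Q" and B: "B \<in> peirce Q Q"
  shows "\<delta> (A * B) = \<delta> A \<lhd> B + A \<rhd> \<delta> B - \<delta> Q \<lhd> A \<lhd> B"
proof -
  have m: "Q * A = A" "A * Q = A" "Q * B = B" "B * Q = B"
    using A B by (auto simp: mem_QQ)
  have AB: "A * B \<in> peirce Q Q"
    using m by (metis mem_QQ mult.assoc)
  have "\<delta> (A * B) - \<delta> A \<lhd> B - A \<rhd> \<delta> B + A \<rhd> \<delta> Q \<lhd> B = 0" (is "?m = 0")
  proof (rule right_faithful_eq_zero[OF rf])
    have "Q \<rhd> A \<rhd> x = A \<rhd> x" for x
      using m by (simp flip: lact_assoc)
    moreover have "Q \<rhd> \<delta> A \<lhd> B = \<delta> A \<lhd> B"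
      using \<delta>_QQ[OF A] by (simp flip: lact_ract_assoc)
    ultimately show "Q \<rhd> ?m = ?m"
      using \<delta>_QQ[OF AB] by (simp add: act_distribs)
  next
    fix W assume W: "W \<in> peirce P Q"
    have WA: "W * A \<in> peirce P Q"
      using m W by (metis mem_PQ mult.assoc)
    have "W \<rhd> \<delta> (A * B) + P \<rhd> \<delta> W \<lhd> Q \<lhd> (A * B) - (W * (A * B)) \<rhd> \<delta> Q =
        (W * A) \<rhd> \<delta> B + (W \<rhd> \<delta> A + P \<rhd> \<delta> W \<lhd> Q \<lhd> A - (W * A) \<rhd> \<delta> Q) \<lhd> B
          - (W * (A * B)) \<rhd> \<delta> Q"
      using \<delta>_right_mult[OF AB W] \<delta>_right_mult[OF B WA] \<delta>_right_mult[OF A W]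
      by (simp add: mult.assoc flip: lact_ract_assoc)
    then show "W \<rhd> ?m = 0"
      by (simp add: act_distribs lact_assoc ract_assoc lact_ract_assoc algebra_simps)
  qed
  then show ?thesis
    using \<delta>Q_commutes[OF rf A] by (simp add: algebra_simps flip: lact_ract_assoc)
qed

lemma generalized_derivation_PP:
  assumes "left_faithful ract P Q"
  shows "\<delta> P \<in> bimod_center lact ract (peirce P P) UNIV"
    and "generalized_derivation_on scaleA scaleM lact ract
      (peirce P P) (peirce_bimod lact ract P P) \<delta>"
  \<comment> \<open>The central element of the generalized derivation is \<open>\<delta> P\<close>
    itself.\<close>
  unfolding generalized_derivation_on_def bimod_center_def
  using \<delta>P_commutes[OF assms] \<delta>_mult_PP[OF assms] \<delta>P_mem \<delta>_PP
  by (auto simp: mem_MPP linear_map_add[OF linear] linear_map_scale[OF linear]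
      intro!: exI[of _ "\<delta> P"])

lemma generalized_derivation_QQ:
  assumes "right_faithful lact P Q"
  shows "\<delta> Q \<in> bimod_center lact ract (peirce Q Q) UNIV"
    and "generalized_derivation_on scaleA scaleM lact ract
      (peirce Q Q) (peirce_bimod lact ract Q Q) \<delta>"
  unfolding generalized_derivation_on_def bimod_center_def
  using \<delta>Q_commutes[OF assms] \<delta>_mult_QQ[OF assms] \<delta>Q_mem \<delta>_QQ
  by (auto simp: mem_MQQ linear_map_add[OF linear] linear_map_scale[OF linear]
      intro!: exI[of _ "\<delta> Q"])

end

section \<open>Normalization by an inner derivation\<close>

text \<open>One inner derivation diagonalizes both \<open>D P\<close> and \<open>D Q\<close>,
  because \<open>J(P, Q) = 0\<close> makes their off-diagonal components opposite and kills
  \<open>Q D(P) Q\<close> and \<open>P D(Q) P\<close>.\<close>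

lemma (in jordan_derivable_peirce) normalized_by_inner:
  obtains \<delta> where "peirce_jordan_identities scaleA scaleM lact ract P Q \<delta>"
    and "inner_derivation lact ract (\<lambda>A. D A - \<delta> A)"
proof -
  \<comment> \<open>The signs make \<open>NP - PN\<close> the off-diagonal part of
    \<open>D P\<close>, while \<open>NQ - QN\<close> is its negative.\<close>
  define N where "N = Q \<rhd> D P \<lhd> P - P \<rhd> D P \<lhd> Q"
  let ?d = "\<lambda>A. D A - (N \<lhd> A - A \<rhd> N)"
  have "J P Q = 0"
    by (rule J_diag) (simp_all add: mem_PP mem_QQ)
  then have sum: "D P \<lhd> Q + P \<rhd> D Q + D Q \<lhd> P + Q \<rhd> D P = 0"
    using linear_map_scale[OF linear_D, of 0 0] by (simp add: jordan_defect_def)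
  have comp: "E \<rhd> (D P \<lhd> Q + P \<rhd> D Q + D Q \<lhd> P + Q \<rhd> D P) \<lhd> F = 0" for E F
    by (simp add: sum)
  have "Q \<rhd> D P \<lhd> Q + Q \<rhd> D P \<lhd> Q = 0" "P \<rhd> D Q \<lhd> P + P \<rhd> D Q \<lhd> P = 0"
    using comp[of P P] comp[of Q Q] by (simp_all add: act_distribs idem_orth_act lact_ract_assoc)
  then have DP: "Q \<rhd> D P \<lhd> Q = 0" and DQ: "P \<rhd> D Q \<lhd> P = 0"
    using add_self_eq_zero_imp two_neq_zero by blast+
  have off: "P \<rhd> D Q \<lhd> Q = - (P \<rhd> D P \<lhd> Q)" "Q \<rhd> D Q \<lhd> P = - (Q \<rhd> D P \<lhd> P)"
    using comp[of P Q] comp[of Q P]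
    by (simp_all add: act_distribs idem_orth_act lact_ract_assoc eq_neg_iff_add_eq_0 add.commute)
  have "?d P = P \<rhd> D P \<lhd> P"
    unfolding N_def using peirce_bimod_decomp[of "D P"] DP
    by (simp add: act_distribs idem_orth_act lact_ract_assoc algebra_simps)
  moreover have "?d Q = Q \<rhd> D Q \<lhd> Q"
    unfolding N_def using peirce_bimod_decomp[of "D Q"] DQ off
    by (simp add: act_distribs idem_orth_act lact_ract_assoc algebra_simps)
  moreover have "Vector_Spaces.linear scaleA scaleM ?d"
    by (rule vector_space_pair.linear_compose_sub[OF _ linear_D linear_inner], unfold_locales)
  ultimately have "peirce_jordan_identities scaleA scaleM lact ract P Q ?d"
    using J_diag J_balanced J_square two_neq_zero
    by (intro peirce_jordan_identities.intro peirce_jordan_identities_axioms.intro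
        peirce_bimodule_axioms)
      (auto simp: jordan_defect_diff_inner mem_MPP mem_MQQ idem_orth_act lact_ract_assoc)
  moreover have "inner_derivation lact ract (\<lambda>A. D A - ?d A)"
    by (auto simp: inner_derivation_def)
  ultimately show thesis
    by (rule that)
qed

theorem theorem2p3:
  fixes scaleA :: "'f::field \<Rightarrow> 'a::ring_1 \<Rightarrow> 'a"
    and scaleM :: "'f \<Rightarrow> 'm::ab_group_add \<Rightarrow> 'm"
    and lact :: "'a \<Rightarrow> 'm \<Rightarrow> 'm" (infixr "\<rhd>" 75)
    and ract :: "'m \<Rightarrow> 'a \<Rightarrow> 'm" (infixl "\<lhd>" 75)
    and P Q C :: 'a
    and \<Delta> :: "'a \<Rightarrow> 'm"
  assumes "CHAR('f) \<noteq> 2"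
    and "infinite (UNIV :: 'f set) \<or> card (UNIV :: 'f set) \<ge> 4"
    and "unital_bimodule scaleA scaleM lact ract"
    and "P * P = P" and "P \<noteq> 0" and "P \<noteq> 1" and "Q = 1 - P"
    and "\<forall>A \<in> peirce P P. A \<in> module.span scaleA (corner_units P)"
    and "\<forall>A \<in> peirce Q Q. A \<in> module.span scaleA (corner_units Q)"
    and "Q * C * P = 0"
    and "Vector_Spaces.linear scaleA scaleM \<Delta>"
    and "jordan_derivable_at lact ract \<Delta> C"
  shows "\<exists>\<delta>. Vector_Spaces.linear scaleA scaleM \<delta> \<and>
    inner_derivation lact ract (\<lambda>A. \<Delta> A - \<delta> A) \<and>
    (\<forall>A \<in> peirce P Q. \<delta> P \<lhd> A = A \<rhd> \<delta> Q) \<and>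
    (\<forall>A \<in> peirce P Q. A \<rhd> \<delta> A = 0 \<and> \<delta> A \<lhd> A = 0) \<and>
    \<delta> ` peirce P P \<subseteq> peirce_bimod lact ract P P \<and>
    \<delta> ` peirce Q Q \<subseteq> peirce_bimod lact ract Q Q \<and>
    (left_faithful ract P Q \<longrightarrow>
       \<delta> P \<in> bimod_center lact ract (peirce P P) UNIV \<and>
       generalized_derivation_on scaleA scaleM lact ract
         (peirce P P) (peirce_bimod lact ract P P) \<delta>) \<and>
    (right_faithful lact P Q \<longrightarrow>
       \<delta> Q \<in> bimod_center lact ract (peirce Q Q) UNIV \<and>
       generalized_derivation_on scaleA scaleM lact ract
         (peirce Q Q) (peirce_bimod lact ract Q Q) \<delta>)"
proof -
  interpret jordan_derivable_peirce scaleA scaleM lact ract P Q C \<Delta>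
    using assms two_neq_zero_of_CHAR
    by (simp add: jordan_derivable_peirce_def jordan_derivable_peirce_axioms_def
        peirce_bimodule_def peirce_bimodule_axioms_def)
  obtain \<delta> where "peirce_jordan_identities scaleA scaleM lact ract P Q \<delta>"
    and inner: "inner_derivation lact ract (\<lambda>A. \<Delta> A - \<delta> A)"
    using normalized_by_inner .
  then interpret \<delta>: peirce_jordan_identities scaleA scaleM lact ract P Q \<delta>
    by simp
  have "\<delta> ` peirce P P \<subseteq> peirce_bimod lact ract P P"
    and "\<delta> ` peirce Q Q \<subseteq> peirce_bimod lact ract Q Q"
    using \<delta>.\<delta>_PP \<delta>.\<delta>_QQ by (auto simp: mem_MPP mem_MQQ)
  then show ?thesis
    using inner \<delta>.linear \<delta>.\<delta>_PQ(1) \<delta>.\<delta>_PQ_annihilates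
      \<delta>.generalized_derivation_PP \<delta>.generalized_derivation_QQ
    by (intro exI[of _ \<delta>] conjI ballI impI) simp_all
qed

end
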